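(* For every space $X$, with $q\colon X_{cc}^I\to X_{cc}\times X_{cc}$ the path fibration $q(\gamma)=(\gamma(0),\gamma(1))$ and $\Delta\colon X_{cc}\to X_{cc}\times X_{cc}$ the diagonal map (both regarded as exterior maps), $$\mathrm{p\text{-}TC}(X)=\mathrm{e\text{-}TC}(X_{cc})=\mathrm{e\text{-}secat}\bigl(q\colon X_{cc}^I\to X_{cc}\times X_{cc}\bigr),$$ and moreover $$\mathrm{p\text{-}TC}(X)=\mathrm{e\text{-}secat}\bigl(\Delta\colon X_{cc}\to X_{cc}\times X_{cc}\bigr).$$
   Context: All spaces are assumed metrizable. Write $I=[0,1]$. Exterior spaces. An exterior space is a topological space $(X,\tau)$ with a nonempty family $\mathcal E\subseteq\tau$ (the externology; its members are the exterior sets) closed under finite intersections and such that $U\in\tau$, $U\supseteq E\in\mathcal E$ implies $U\in\mathcal E$. A map of exterior spaces is exterior if it is continuous and preimages of exterior sets are exterior. A subspace $A$ of an exterior space carries the relative externology (the coarsest one making the inclusion exterior): the open subsets of $A$ containing $E\cap A$ for some exterior $E$. The product $X\times Y$ carries the externology of open sets containing $E\times E'$ for some exterior $E\subseteq X$, $E'\subseteq Y$. $I_{tr}$ is $I$ with externology $\{I\}$; an exterior homotopy between exterior maps $X\to Y$ is a homotopy that is an exterior map $X\times I_{tr}\to Y$, and we write $\simeq_e$. The path space $X^I$ (compact-open topology) of an exterior space $X$ carries the externology of open sets containing $\{\gamma\in X^I:\gamma(I)\subseteq E\}$ for some exterior $E\subseteq X$. For a space $X$, $X_{cc}$ is $X$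 with the cocompact externology, formed by the complements of closed compact subspaces. Exterior sectional category. Let $f\colon X\to Y$ be an exterior map. An open subset $U\subseteq Y$ (not necessarily exterior, with the relative externology) is e-sectional if there is an exterior map $s\colon U\to X$ with $f\circ s$ exterior homotopic to the inclusion $U\hookrightarrow Y$. $\mathrm{e\text{-}secat}(f)$ is the least integer $k$ such that $Y$ is covered by $k+1$ e-sectional open subsets ($\infty$ if there is none). Exterior topological complexity. For an exterior space $X$, $\mathrm{e\text{-}TC}(X)$ is the least $n$ (or $\infty$) such that $X\times X$ is covered by $n+1$ open sets $U_0,\dots,U_n$ on each of which there is an exterior map $\sigma_i\colon U_i\to X^I$ which is a (strict) local section of $q\colon X^I\to X\times X$, $q(\gamma)=(\gamma(0),\gamma(1))$. Proper topological complexity. For a space $X$, $\mathrm{p\text{-}TC}(X)$ is the least $n$ (or $\infty$) such that $X\times X$ is covered by $n+1$ open sets $U_0,\dots,U_n$ with continuous local sections $\sigma_i\colon U_i\to X^I$ of $q$ such that: every compact $K\subseteq X$ is contained in a compact $L\subseteq X$ with $\operatorname{Im}\sigma_i(x,y)\subseteq X\setminus K$ for all $(x,y)\in U_i\cap\bigl((X\setminus L)\times (X\setminus L)\bigr)$. *)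

theory Defs
  imports "HOL-Analysis.Analysis"
begin

section \<open>Exterior spaces\<close>

definition externology :: "'a topology \<Rightarrow> 'a set set \<Rightarrow> bool" where
  "externology T \<E> \<longleftrightarrow>
     \<E> \<noteq> {} \<and> (\<forall>E\<in>\<E>. openin T E) \<and> (\<forall>E\<in>\<E>. \<forall>E'\<in>\<E>. E \<inter> E' \<in> \<E>) \<and>
     (\<forall>E\<in>\<E>. \<forall>U. openin T U \<and> E \<subseteq> U \<longrightarrow> U \<in> \<E>)"

lemma externologyD:
  assumes "externology T \<E>"
  shows "\<E> \<noteq> {}"
    and "E \<in> \<E> \<Longrightarrow> openin T E"
    and "E \<in> \<E> \<Longrightarrow> E' \<in> \<E> \<Longrightarrow> E \<inter> E' \<in> \<E>"
    and "E \<in> \<E> \<Longrightarrow> openin T U \<Longrightarrow> E \<subseteq> U \<Longrightarrow> U \<in> \<E>"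
  using assms unfolding externology_def by blast+

lemma externology_generated:
  assumes ne: "\<B> \<noteq> {}" and sub: "\<And>B. B \<in> \<B> \<Longrightarrow> B \<subseteq> topspace T"
    and int: "\<And>B B'. B \<in> \<B> \<Longrightarrow> B' \<in> \<B> \<Longrightarrow> \<exists>C\<in>\<B>. C \<subseteq> B \<inter> B'"
  shows "externology T {V. openin T V \<and> (\<exists>B\<in>\<B>. B \<subseteq> V)}"
  unfolding externology_def
proof (intro conjI ballI allI impI)
  show "{V. openin T V \<and> (\<exists>B\<in>\<B>. B \<subseteq> V)} \<noteq> {}"
    using ne sub openin_topspace[of T] by blast
next
  fix V V' assume V: "V \<in> {V. openin T V \<and> (\<exists>B\<in>\<B>. B \<subseteq> V)}" "V' \<in> {V. openin T V \<and> (\<exists>B\<in>\<B>. B \<subseteq> V)}"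
  then obtain B B' where "B \<in> \<B>" "B \<subseteq> V" "B' \<in> \<B>" "B' \<subseteq> V'" by auto
  with int[of B B'] have "\<exists>C\<in>\<B>. C \<subseteq> V \<inter> V'" by (meson Int_mono order_trans)
  with V show "V \<inter> V' \<in> {V. openin T V \<and> (\<exists>B\<in>\<B>. B \<subseteq> V)}" by (simp add: openin_Int)
next
  show "openin T V" if "V \<in> {V. openin T V \<and> (\<exists>B\<in>\<B>. B \<subseteq> V)}" for V
    using that by simp
next
  show "U \<in> {V. openin T V \<and> (\<exists>B\<in>\<B>. B \<subseteq> V)}"
    if "V \<in> {V. openin T V \<and> (\<exists>B\<in>\<B>. B \<subseteq> V)}" "openin T U \<and> V \<subseteq> U" for V U
    using that by (auto intro: order_trans)
qed

typedef 'a exterior_space = "{(T :: 'a topology, \<E>). externology T \<E>}"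
proof
  show "(discrete_topology UNIV, UNIV) \<in> {(T :: 'a topology, \<E>). externology T \<E>}"
    by (auto simp: externology_def)
qed

setup_lifting type_definition_exterior_space

lift_definition topology_of :: "'a exterior_space \<Rightarrow> 'a topology" is fst .

lift_definition exterior_in :: "'a exterior_space \<Rightarrow> 'a set \<Rightarrow> bool"
  is "\<lambda>(T, \<E>) E. E \<in> \<E>" .

abbreviation points :: "'a exterior_space \<Rightarrow> 'a set" where
  "points X \<equiv> topspace (topology_of X)"

definition exterior_map :: "'a exterior_space \<Rightarrow> 'b exterior_space \<Rightarrow> ('a \<Rightarrow> 'b) \<Rightarrow> bool" where
  "exterior_map X Y f \<longleftrightarrow>
     continuous_map (topology_of X) (topology_of Y) f \<and>
     (\<forall>E. exterior_in Y E \<longrightarrow> exterior_in X {x \<in> points X. f x \<in> E})"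

lemma externology_subspace:
  assumes "externology T \<E>"
  shows "externology (subtopology T A)
    {V. openin (subtopology T A) V \<and> (\<exists>E\<in>\<E>. E \<inter> A \<subseteq> V)}"
proof -
  have "externology (subtopology T A)
      {V. openin (subtopology T A) V \<and> (\<exists>B\<in>(\<lambda>E. E \<inter> A) ` \<E>. B \<subseteq> V)}"
  proof (rule externology_generated)
    show "(\<lambda>E. E \<inter> A) ` \<E> \<noteq> {}" using externologyD(1)[OF assms] by simp
    show "B \<subseteq> topspace (subtopology T A)" if "B \<in> (\<lambda>E. E \<inter> A) ` \<E>" for B
      using that externologyD(2)[OF assms] openin_subset[of T] by fastforce
    show "\<exists>C\<in>(\<lambda>E. E \<inter> A) ` \<E>. C \<subseteq> B \<inter> B'"
      if "B \<in> (\<lambda>E. E \<inter> A) ` \<E>" "B' \<in> (\<lambda>E. E \<inter> A) ` \<E>" for B B'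
    proof -
      from that obtain E E' where "E \<in> \<E>" "E' \<in> \<E>" "B = E \<inter> A" "B' = E' \<inter> A" by auto
      then show ?thesis
        using externologyD(3)[OF assms, of E E'] by (intro bexI[of _ "E \<inter> E' \<inter> A"]) auto
    qed
  qed
  then show ?thesis by simp
qed

lift_definition exterior_subspace :: "'a exterior_space \<Rightarrow> 'a set \<Rightarrow> 'a exterior_space"
  is "\<lambda>(T, \<E>) A. (subtopology T A, {V. openin (subtopology T A) V \<and> (\<exists>E\<in>\<E>. E \<inter> A \<subseteq> V)})"
  by (auto intro: externology_subspace)

lemma externology_prod:
  assumes T: "externology T \<E>" and S: "externology S \<F>"
  shows "externology (prod_topology T S)
    {V. openin (prod_topology T S) V \<and> (\<exists>E\<in>\<E>. \<exists>F\<in>\<F>. E \<times> F \<subseteq> V)}"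
proof -
  let ?B = "(\<lambda>(E, F). E \<times> F) ` (\<E> \<times> \<F>)"
  have "externology (prod_topology T S)
      {V. openin (prod_topology T S) V \<and> (\<exists>B\<in>?B. B \<subseteq> V)}"
  proof (rule externology_generated)
    show "?B \<noteq> {}" using externologyD(1)[OF T] externologyD(1)[OF S] by auto
    show "B \<subseteq> topspace (prod_topology T S)" if "B \<in> ?B" for B
      using that externologyD(2)[OF T] externologyD(2)[OF S] openin_subset[of T] openin_subset[of S]
      by fastforce
    show "\<exists>C\<in>?B. C \<subseteq> B \<inter> B'" if "B \<in> ?B" "B' \<in> ?B" for B B'
    proof -
      from that obtain E F E' F' where "E \<in> \<E>" "F \<in> \<F>" "E' \<in> \<E>" "F' \<in> \<F>"
        "B = E \<times> F" "B' = E' \<times> F'" by auto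
      then show ?thesis
        using externologyD(3)[OF T, of E E'] externologyD(3)[OF S, of F F']
        by (intro bexI[of _ "(E \<inter> E') \<times> (F \<inter> F')"]) auto
    qed
  qed
  then show ?thesis by simp
qed

lift_definition exterior_prod ::
    "'a exterior_space \<Rightarrow> 'b exterior_space \<Rightarrow> ('a \<times> 'b) exterior_space"
  is "\<lambda>(T, \<E>) (S, \<F>). (prod_topology T S,
        {V. openin (prod_topology T S) V \<and> (\<exists>E\<in>\<E>. \<exists>F\<in>\<F>. E \<times> F \<subseteq> V)})"
  by (auto intro: externology_prod)

lift_definition trivial_exterior :: "'a topology \<Rightarrow> 'a exterior_space"
  is "\<lambda>T. (T, {topspace T})"
  by (auto simp: externology_def dest: openin_subset)

definition I_tr :: "real exterior_space" where
  "I_tr = trivial_exterior (top_of_set {0..1})"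

lemma externology_cocompact:
  "externology T {topspace T - K | K. closedin T K \<and> compactin T K}" (is "externology T ?E")
  unfolding externology_def
proof (intro conjI ballI allI impI)
  have "topspace T - {} \<in> ?E" using closedin_empty compactin_empty by blast
  then show "?E \<noteq> {}" by blast
next
  show "openin T V" if "V \<in> ?E" for V using that by auto
next
  fix V V' assume "V \<in> ?E" "V' \<in> ?E"
  then obtain K K' where K: "V = topspace T - K" "closedin T K" "compactin T K"
    "V' = topspace T - K'" "closedin T K'" "compactin T K'" by auto
  have "V \<inter> V' = topspace T - (K \<union> K')" using K by auto
  then show "V \<inter> V' \<in> ?E" using K compactin_Un closedin_Un by blast
next
  fix V U assume "V \<in> ?E" and U: "openin T U \<and> V \<subseteq> U"
  then obtain K where K: "V = topspace T - K" "closedin T K" "compactin T K" by auto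
  have "closedin T (topspace T - U)" using U by auto
  moreover have "topspace T - U \<subseteq> K" using U K by auto
  moreover have "U = topspace T - (topspace T - U)" using U openin_subset[of T U] by auto
  ultimately show "U \<in> ?E" using closed_compactin[OF K(3)] by blast
qed

text \<open>For Hausdorff (in particular metrizable) spaces the condition \<open>closedin T K\<close> is automatic.\<close>

lift_definition cocompact :: "'a topology \<Rightarrow> 'a exterior_space"
  is "\<lambda>T. (T, {topspace T - K | K. closedin T K \<and> compactin T K})"
  by (auto intro: externology_cocompact)

section \<open>Path spaces\<close>

text \<open>Paths are taken extensional (i.e. \<open>undefined\<close> outside the unit interval), so that
  elements of the path space correspond one-to-one to continuous maps \<open>I \<rightarrow> X\<close>.\<close>

definition compact_open_topology :: "'a topology \<Rightarrow> 'b topology \<Rightarrow> ('a \<Rightarrow> 'b) topology" where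
  "compact_open_topology T S = topology_generated_by
     {{f \<in> extensional (topspace T). continuous_map T S f \<and> f ` K \<subseteq> U} | K U.
        compactin T K \<and> openin S U}"

definition path_topology :: "'a topology \<Rightarrow> (real \<Rightarrow> 'a) topology" where
  "path_topology T = compact_open_topology (top_of_set {0..1}) T"

lemma openin_path_topology_image_subset:
  assumes "compact K" "K \<subseteq> {0..1}" "openin T U"
  shows "openin (path_topology T)
    {\<gamma> \<in> extensional {0..1}. continuous_map (top_of_set {0..1}) T \<gamma> \<and> \<gamma> ` K \<subseteq> U}"
  unfolding path_topology_def compact_open_topology_def
  by (rule topology_generated_by_Basis)
     (use assms in \<open>auto simp: compactin_subtopology intro!: exI[of _ K] exI[of _ U]\<close>)

lemma topspace_path_topology:
  "topspace (path_topology T) =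
     {\<gamma> \<in> extensional {0..1}. continuous_map (top_of_set {0..1}) T \<gamma>}" (is "_ = ?C")
proof
  show "topspace (path_topology T) \<subseteq> ?C"
    by (auto simp: path_topology_def compact_open_topology_def topology_generated_by_topspace)
  show "?C \<subseteq> topspace (path_topology T)"
    using openin_subset[OF openin_path_topology_image_subset[of "{}" T "topspace T"]] by simp
qed

lemma externology_path:
  assumes "externology T \<E>"
  shows "externology (path_topology T) {V. openin (path_topology T) V \<and>
    (\<exists>E\<in>\<E>. {\<gamma> \<in> topspace (path_topology T). \<gamma> ` {0..1} \<subseteq> E} \<subseteq> V)}"
proof -
  let ?P = "\<lambda>E. {\<gamma> \<in> topspace (path_topology T). \<gamma> ` {0..1} \<subseteq> E}"
  have "externology (path_topology T)
      {V. openin (path_topology T) V \<and> (\<exists>B\<in>?P ` \<E>. B \<subseteq> V)}"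
  proof (rule externology_generated)
    show "?P ` \<E> \<noteq> {}" using externologyD(1)[OF assms] by simp
    show "B \<subseteq> topspace (path_topology T)" if "B \<in> ?P ` \<E>" for B
      using that by auto
    show "\<exists>C\<in>?P ` \<E>. C \<subseteq> B \<inter> B'" if "B \<in> ?P ` \<E>" "B' \<in> ?P ` \<E>" for B B'
    proof -
      from that obtain E E' where "E \<in> \<E>" "E' \<in> \<E>" "B = ?P E" "B' = ?P E'" by auto
      then show ?thesis
        using externologyD(3)[OF assms, of E E'] by (intro bexI[of _ "?P (E \<inter> E')"] imageI) auto
    qed
  qed
  then show ?thesis by simp
qed

lift_definition exterior_path_space :: "'a exterior_space \<Rightarrow> (real \<Rightarrow> 'a) exterior_space"
  is "\<lambda>(T, \<E>). (path_topology T, {V. openin (path_topology T) V \<and>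
        (\<exists>E\<in>\<E>. {\<gamma> \<in> topspace (path_topology T). \<gamma> ` {0..1} \<subseteq> E} \<subseteq> V)})"
  by (auto intro: externology_path)

definition endpoints :: "(real \<Rightarrow> 'a) \<Rightarrow> 'a \<times> 'a" where
  "endpoints \<gamma> = (\<gamma> 0, \<gamma> 1)"

definition diagonal :: "'a \<Rightarrow> 'a \<times> 'a" where
  "diagonal x = (x, x)"

section \<open>Exterior homotopy and the numerical invariants\<close>

definition exterior_homotopic ::
    "'a exterior_space \<Rightarrow> 'b exterior_space \<Rightarrow> ('a \<Rightarrow> 'b) \<Rightarrow> ('a \<Rightarrow> 'b) \<Rightarrow> bool" where
  "exterior_homotopic X Y f g \<longleftrightarrow>
     exterior_map X Y f \<and> exterior_map X Y g \<and>
     (\<exists>H. exterior_map (exterior_prod X I_tr) Y H \<and>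
          (\<forall>x \<in> points X. H (x, 0) = f x \<and> H (x, 1) = g x))"

definition e_sectional ::
    "'a exterior_space \<Rightarrow> 'b exterior_space \<Rightarrow> ('a \<Rightarrow> 'b) \<Rightarrow> 'b set \<Rightarrow> bool" where
  "e_sectional X Y f U \<longleftrightarrow>
     openin (topology_of Y) U \<and>
     (\<exists>s. exterior_map (exterior_subspace Y U) X s \<and>
          exterior_homotopic (exterior_subspace Y U) Y (f \<circ> s) (\<lambda>y. y))"

text \<open>In the following, the infimum in \<^typ>\<open>enat\<close> of the empty set is \<open>\<infinity>\<close>.\<close>

definition e_secat :: "'a exterior_space \<Rightarrow> 'b exterior_space \<Rightarrow> ('a \<Rightarrow> 'b) \<Rightarrow> enat" where
  "e_secat X Y f = Inf {enat k | k. \<exists>U :: nat \<Rightarrow> 'b set.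
     (\<forall>i\<le>k. e_sectional X Y f (U i)) \<and> (\<Union>i\<le>k. U i) = points Y}"

definition e_TC :: "'a exterior_space \<Rightarrow> enat" where
  "e_TC X = Inf {enat n | n. \<exists>U :: nat \<Rightarrow> ('a \<times> 'a) set.
     (\<forall>i\<le>n. openin (topology_of (exterior_prod X X)) (U i) \<and>
        (\<exists>\<sigma>. exterior_map (exterior_subspace (exterior_prod X X) (U i)) (exterior_path_space X) \<sigma> \<and>
             (\<forall>p \<in> U i. endpoints (\<sigma> p) = p))) \<and>
     (\<Union>i\<le>n. U i) = points (exterior_prod X X)}"

definition p_TC :: "'a topology \<Rightarrow> enat" where
  "p_TC T = Inf {enat n | n. \<exists>U :: nat \<Rightarrow> ('a \<times> 'a) set.
     (\<forall>i\<le>n. openin (prod_topology T T) (U i) \<and>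
        (\<exists>\<sigma>. continuous_map (subtopology (prod_topology T T) (U i)) (path_topology T) \<sigma> \<and>
             (\<forall>p \<in> U i. endpoints (\<sigma> p) = p) \<and>
             (\<forall>K. compactin T K \<longrightarrow>
                (\<exists>L. compactin T L \<and> K \<subseteq> L \<and>
                   (\<forall>p \<in> U i \<inter> (topspace T - L) \<times> (topspace T - L).
                      \<sigma> p ` {0..1} \<subseteq> topspace T - K))))) \<and>
     (\<Union>i\<le>n. U i) = topspace (prod_topology T T)}"

section \<open>Unfolding the constructions; the maps under consideration are exterior\<close>

lemma topology_of_simps [simp]:
  "topology_of (exterior_subspace X A) = subtopology (topology_of X) A"
  "topology_of (exterior_prod X Y) = prod_topology (topology_of X) (topology_of Y)"
  "topology_of (trivial_exterior T) = T"
  "topology_of (cocompact T) = T"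
  "topology_of (exterior_path_space X) = path_topology (topology_of X)"
  "topology_of I_tr = top_of_set {0..1}"
  by (simp_all add: I_tr_def topology_of.rep_eq exterior_subspace.rep_eq exterior_prod.rep_eq
      trivial_exterior.rep_eq cocompact.rep_eq exterior_path_space.rep_eq split_beta)

lemma externology_exterior_in: "externology (topology_of X) {E. exterior_in X E}"
  by transfer auto

lemma exterior_in_subspace:
  "exterior_in (exterior_subspace X A) V \<longleftrightarrow>
     openin (subtopology (topology_of X) A) V \<and> (\<exists>E. exterior_in X E \<and> E \<inter> A \<subseteq> V)"
  by (simp add: exterior_in.rep_eq topology_of.rep_eq exterior_subspace.rep_eq split_beta Bex_def)

lemma exterior_in_prod:
  "exterior_in (exterior_prod X Y) V \<longleftrightarrow>
     openin (prod_topology (topology_of X) (topology_of Y)) V \<and>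
     (\<exists>E E'. exterior_in X E \<and> exterior_in Y E' \<and> E \<times> E' \<subseteq> V)"
  by (simp add: exterior_in.rep_eq topology_of.rep_eq exterior_prod.rep_eq split_beta Bex_def)

lemma exterior_in_I_tr: "exterior_in I_tr E \<longleftrightarrow> E = {0..1}"
  by (simp add: exterior_in.rep_eq topology_of.rep_eq I_tr_def trivial_exterior.rep_eq split_beta Bex_def)

lemma exterior_in_cocompact:
  "exterior_in (cocompact T) E \<longleftrightarrow> (\<exists>K. E = topspace T - K \<and> closedin T K \<and> compactin T K)"
  by (simp add: exterior_in.rep_eq topology_of.rep_eq cocompact.rep_eq split_beta Bex_def)

lemma exterior_in_path_space:
  "exterior_in (exterior_path_space X) V \<longleftrightarrow>
     openin (path_topology (topology_of X)) V \<and>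
     (\<exists>E. exterior_in X E \<and>
        {\<gamma> \<in> topspace (path_topology (topology_of X)). \<gamma> ` {0..1} \<subseteq> E} \<subseteq> V)"
  by (simp add: exterior_in.rep_eq topology_of.rep_eq exterior_path_space.rep_eq split_beta Bex_def)

lemma exterior_map_diagonal: "exterior_map X (exterior_prod X X) diagonal"
proof -
  note ext = externologyD[OF externology_exterior_in[of X], unfolded mem_Collect_eq]
  have c: "continuous_map (topology_of X) (prod_topology (topology_of X) (topology_of X)) diagonal"
    unfolding diagonal_def by (simp add: continuous_map_pairedI)
  have "exterior_in X {x \<in> points X. diagonal x \<in> V}"
    if V: "exterior_in (exterior_prod X X) V" for V
  proof -
    obtain E E' where E: "exterior_in X E" "exterior_in X E'" "E \<times> E' \<subseteq> V"
      using V unfolding exterior_in_prod by (elim conjE exE)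
    have "E \<subseteq> points X"
      by (rule openin_subset[OF ext(2)[OF E(1)]])
    then have "E \<inter> E' \<subseteq> {x \<in> points X. diagonal x \<in> V}"
      using E(3) by (auto simp: diagonal_def)
    moreover have "openin (topology_of X) {x \<in> points X. diagonal x \<in> V}"
      by (rule openin_continuous_map_preimage[OF c]) (rule V[unfolded exterior_in_prod, THEN conjunct1])
    ultimately show ?thesis by (intro ext(4)[OF ext(3)[OF E(1,2)]])
  qed
  with c show ?thesis by (simp add: exterior_map_def)
qed

lemma continuous_map_path_eval:
  assumes "t \<in> {0..1}"
  shows "continuous_map (path_topology T) T (\<lambda>\<gamma>. \<gamma> t)"
  unfolding continuous_map_def
proof (intro conjI allI impI)
  show "(\<lambda>\<gamma>. \<gamma> t) \<in> topspace (path_topology T) \<rightarrow> topspace T"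
    using assms by (auto simp: topspace_path_topology continuous_map_def)
  show "openin (path_topology T) {\<gamma> \<in> topspace (path_topology T). \<gamma> t \<in> U}" if "openin T U" for U
    using openin_path_topology_image_subset[of "{t}" T U] that assms
    by (simp add: topspace_path_topology)
qed

lemma exterior_map_endpoints:
  "exterior_map (exterior_path_space X) (exterior_prod X X) endpoints"
proof -
  let ?P = "path_topology (topology_of X)"
  note ext = externologyD[OF externology_exterior_in[of X], unfolded mem_Collect_eq]
  have c: "continuous_map ?P (prod_topology (topology_of X) (topology_of X)) endpoints"
    unfolding endpoints_def by (simp add: continuous_map_pairedI continuous_map_path_eval)
  have "exterior_in (exterior_path_space X) {\<gamma> \<in> topspace ?P. endpoints \<gamma> \<in> V}"
    if V: "exterior_in (exterior_prod X X) V" for V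
  proof -
    obtain E E' where E: "exterior_in X E" "exterior_in X E'" "E \<times> E' \<subseteq> V"
      using V unfolding exterior_in_prod by (elim conjE exE)
    have "endpoints \<gamma> \<in> V" if "\<gamma> ` {0..1} \<subseteq> E \<inter> E'" for \<gamma>
    proof -
      have "\<gamma> 0 \<in> E" "\<gamma> 1 \<in> E'" using that by (auto simp: image_subset_iff)
      then show ?thesis using E(3) by (auto simp: endpoints_def)
    qed
    then have "{\<gamma> \<in> topspace ?P. \<gamma> ` {0..1} \<subseteq> E \<inter> E'} \<subseteq> {\<gamma> \<in> topspace ?P. endpoints \<gamma> \<in> V}"
      by blast
    moreover have "openin ?P {\<gamma> \<in> topspace ?P. endpoints \<gamma> \<in> V}"
      by (rule openin_continuous_map_preimage[OF c]) (rule V[unfolded exterior_in_prod, THEN conjunct1])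
    ultimately show ?thesis
      unfolding exterior_in_path_space by (intro conjI exI[of _ "E \<inter> E'"] ext(3)[OF E(1,2)])
  qed
  with c show ?thesis by (simp add: exterior_map_def)
qed

end

theory Submission
  imports Defs
begin

text \<open>
  The four covering conditions already agree for each single open set. An exterior map
  \<open>Z \<times> I_tr \<rightarrow> X\<close> is the same thing as an exterior map \<open>Z \<rightarrow> X\<^sup>I\<close>. Hence, if \<open>H\<close> is an exterior
  homotopy from \<open>q \<circ> s\<close> to an inclusion, running the first component of \<open>H\<close> backwards, then
  \<open>s\<close>, then the second component of \<open>H\<close> turns \<open>s\<close> into a strict section of \<open>q\<close>. The diagonal
  and \<open>q\<close> have the same sectional sets because they correspond to each other, up to exterior
  homotopy over \<open>X \<times> X\<close>, under constant paths and evaluation at \<open>0\<close>. For Hausdorff \<open>X\<close>, the condition in the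
  proper topological complexity says precisely that a section is exterior for the cocompact
  externology.
\<close>

section \<open>Exterior maps\<close>

lemma exterior_in_openin: "exterior_in X E \<Longrightarrow> openin (topology_of X) E"
  using externologyD(2)[OF externology_exterior_in[of X]] by simp

lemma exterior_in_subset: "exterior_in X E \<Longrightarrow> E \<subseteq> points X"
  by (simp add: exterior_in_openin openin_subset)

lemma exterior_in_Int: "exterior_in X E \<Longrightarrow> exterior_in X F \<Longrightarrow> exterior_in X (E \<inter> F)"
  using externologyD(3)[OF externology_exterior_in[of X]] by simp

lemma exterior_in_superset:
  "exterior_in X E \<Longrightarrow> openin (topology_of X) U \<Longrightarrow> E \<subseteq> U \<Longrightarrow> exterior_in X U"
  using externologyD(4)[OF externology_exterior_in[of X]] by simp

lemma exterior_in_points: "exterior_in X (points X)"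
proof -
  obtain E where "exterior_in X E"
    using externologyD(1)[OF externology_exterior_in[of X]] by blast
  then show ?thesis
    using exterior_in_superset exterior_in_subset openin_topspace by blast
qed

text \<open>The preimage of an exterior set is open by continuity, so by upward closure it is
  exterior as soon as it contains some exterior \<open>F\<close>. Later proofs therefore only have
  to exhibit such an \<open>F\<close>.\<close>

lemma exterior_map_iff:
  "exterior_map X Y f \<longleftrightarrow> continuous_map (topology_of X) (topology_of Y) f \<and>
     (\<forall>E. exterior_in Y E \<longrightarrow> (\<exists>F. exterior_in X F \<and> f ` F \<subseteq> E))"
proof (intro iffI conjI allI impI)
  assume f: "exterior_map X Y f"
  then show "continuous_map (topology_of X) (topology_of Y) f"
    by (simp add: exterior_map_def)
  show "\<exists>F. exterior_in X F \<and> f ` F \<subseteq> E" if "exterior_in Y E" for E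
    using f that unfolding exterior_map_def
    by (intro exI[of _ "{x \<in> points X. f x \<in> E}"]) auto
next
  assume f: "continuous_map (topology_of X) (topology_of Y) f \<and>
     (\<forall>E. exterior_in Y E \<longrightarrow> (\<exists>F. exterior_in X F \<and> f ` F \<subseteq> E))"
  have "exterior_in X {x \<in> points X. f x \<in> E}" if E: "exterior_in Y E" for E
  proof -
    obtain F where F: "exterior_in X F" "f ` F \<subseteq> E"
      using f E by blast
    have "openin (topology_of X) {x \<in> points X. f x \<in> E}"
      using f exterior_in_openin[OF E] openin_continuous_map_preimage by blast
    then show ?thesis
      using F exterior_in_subset[OF F(1)] by (intro exterior_in_superset[OF F(1)]) auto
  qed
  with f show "exterior_map X Y f"
    by (simp add: exterior_map_def)
qed

lemma exterior_map_continuous: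
  "exterior_map X Y f \<Longrightarrow> continuous_map (topology_of X) (topology_of Y) f"
  by (simp add: exterior_map_def)

lemma exterior_map_points: "exterior_map X Y f \<Longrightarrow> x \<in> points X \<Longrightarrow> f x \<in> points Y"
  by (auto dest!: exterior_map_continuous simp: continuous_map_def)

lemma exterior_map_exteriorE:
  assumes "exterior_map X Y f" "exterior_in Y E"
  obtains F where "exterior_in X F" "\<And>x. x \<in> F \<Longrightarrow> f x \<in> E"
  using assms unfolding exterior_map_iff by (metis image_subset_iff)

text \<open>Functions are total, while the notion only sees their values on \<open>points X\<close>.
  This allows a map to be replaced by a more convenient formula.\<close>

lemma exterior_map_cong:
  assumes f: "exterior_map X Y f" and eq: "\<And>x. x \<in> points X \<Longrightarrow> f x = g x"
  shows "exterior_map X Y g"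
proof -
  have "{x \<in> points X. g x \<in> E} = {x \<in> points X. f x \<in> E}" for E
    using eq by auto
  then show ?thesis
    using f eq unfolding exterior_map_def by (auto intro: continuous_map_eq)
qed

lemma exterior_map_compose:
  assumes f: "exterior_map X Y f" and g: "exterior_map Y Z g"
  shows "exterior_map X Z (g \<circ> f)"
  unfolding exterior_map_iff
proof (intro conjI allI impI)
  show "continuous_map (topology_of X) (topology_of Z) (g \<circ> f)"
    using assms by (auto dest!: exterior_map_continuous intro: continuous_map_compose)
  fix E assume "exterior_in Z E"
  then obtain F where F: "exterior_in Y F" "\<And>y. y \<in> F \<Longrightarrow> g y \<in> E"
    using exterior_map_exteriorE[OF g] by metis
  obtain G where "exterior_in X G" "\<And>x. x \<in> G \<Longrightarrow> f x \<in> F"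
    using exterior_map_exteriorE[OF f F(1)] by metis
  with F(2) show "\<exists>G. exterior_in X G \<and> (g \<circ> f) ` G \<subseteq> E"
    by (intro exI[of _ G]) auto
qed

lemma exterior_map_ident: "exterior_map X X (\<lambda>x. x)"
  unfolding exterior_map_iff by (auto simp: image_ident)

lemma exterior_map_inclusion: "exterior_map (exterior_subspace X A) X (\<lambda>x. x)"
  unfolding exterior_map_iff
proof (intro conjI allI impI)
  show "continuous_map (topology_of (exterior_subspace X A)) (topology_of X) (\<lambda>x. x)"
    by simp
  fix E assume E: "exterior_in X E"
  then have "exterior_in (exterior_subspace X A) (E \<inter> A)"
    using exterior_in_openin[OF E] unfolding exterior_in_subspace openin_subtopology by blast
  then show "\<exists>F. exterior_in (exterior_subspace X A) F \<and> (\<lambda>x. x) ` F \<subseteq> E"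
    by blast
qed

section \<open>Products of exterior spaces\<close>

lemma exterior_in_Times:
  assumes "exterior_in X E" "exterior_in Y F"
  shows "exterior_in (exterior_prod X Y) (E \<times> F)"
  using assms unfolding exterior_in_prod
  by (auto simp: openin_prod_Times_iff exterior_in_openin)

lemma exterior_map_fst: "exterior_map (exterior_prod X Y) X fst"
  unfolding exterior_map_iff
proof (intro conjI allI impI)
  show "\<exists>F. exterior_in (exterior_prod X Y) F \<and> fst ` F \<subseteq> E" if "exterior_in X E" for E
    using exterior_in_Times[OF that exterior_in_points] by fastforce
qed (simp add: continuous_map_fst)

lemma exterior_map_snd: "exterior_map (exterior_prod X Y) Y snd"
  unfolding exterior_map_iff
proof (intro conjI allI impI)
  show "\<exists>F. exterior_in (exterior_prod X Y) F \<and> snd ` F \<subseteq> E" if "exterior_in Y E" for E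
    using exterior_in_Times[OF exterior_in_points that] by fastforce
qed (simp add: continuous_map_snd)

lemma exterior_map_pairI:
  assumes f: "exterior_map Z X f" and g: "exterior_map Z Y g"
  shows "exterior_map Z (exterior_prod X Y) (\<lambda>z. (f z, g z))"
  unfolding exterior_map_iff
proof (intro conjI allI impI)
  show "continuous_map (topology_of Z) (topology_of (exterior_prod X Y)) (\<lambda>z. (f z, g z))"
    using assms by (simp add: continuous_map_pairedI exterior_map_continuous)
  fix V assume "exterior_in (exterior_prod X Y) V"
  then obtain E E' where E: "exterior_in X E" "exterior_in Y E'" "E \<times> E' \<subseteq> V"
    unfolding exterior_in_prod by blast
  obtain F where F: "exterior_in Z F" "\<And>z. z \<in> F \<Longrightarrow> f z \<in> E"
    using exterior_map_exteriorE[OF f E(1)] by metis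
  obtain F' where F': "exterior_in Z F'" "\<And>z. z \<in> F' \<Longrightarrow> g z \<in> E'"
    using exterior_map_exteriorE[OF g E(2)] by metis
  show "\<exists>F. exterior_in Z F \<and> (\<lambda>z. (f z, g z)) ` F \<subseteq> V"
    using exterior_in_Int[OF F(1) F'(1)] F(2) F'(2) E(3) by (intro exI[of _ "F \<inter> F'"]) auto
qed

section \<open>Exterior homotopies and the path space\<close>

text \<open>The only exterior subset of \<open>I_tr\<close> is the whole interval, so an exterior
  set of the product contains a full tube \<open>F \<times> {0..1}\<close>. Exteriority of a
  homotopy is thus control near infinity that is uniform in time.\<close>

lemma exterior_map_prod_I_tr_iff:
  "exterior_map (exterior_prod Z I_tr) X h \<longleftrightarrow>
     continuous_map (prod_topology (topology_of Z) (top_of_set {0..1})) (topology_of X) h \<and>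
     (\<forall>E. exterior_in X E \<longrightarrow> (\<exists>F. exterior_in Z F \<and> (\<forall>z\<in>F. \<forall>t\<in>{0..1}. h (z, t) \<in> E)))"
proof -
  have "(\<exists>V. exterior_in (exterior_prod Z I_tr) V \<and> h ` V \<subseteq> E) \<longleftrightarrow>
      (\<exists>F. exterior_in Z F \<and> (\<forall>z\<in>F. \<forall>t\<in>{0..1}. h (z, t) \<in> E))" for E
  proof
    assume "\<exists>V. exterior_in (exterior_prod Z I_tr) V \<and> h ` V \<subseteq> E"
    then obtain V F where "exterior_in Z F" "F \<times> {0..1} \<subseteq> V" "h ` V \<subseteq> E"
      unfolding exterior_in_prod exterior_in_I_tr by auto
    then show "\<exists>F. exterior_in Z F \<and> (\<forall>z\<in>F. \<forall>t\<in>{0..1}. h (z, t) \<in> E)"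
      by (intro exI[of _ F]) auto
  next
    assume "\<exists>F. exterior_in Z F \<and> (\<forall>z\<in>F. \<forall>t\<in>{0..1}. h (z, t) \<in> E)"
    then obtain F where F: "exterior_in Z F" "\<forall>z\<in>F. \<forall>t\<in>{0..1}. h (z, t) \<in> E"
      by blast
    have "exterior_in (exterior_prod Z I_tr) (F \<times> {0..1})"
      using F(1) by (intro exterior_in_Times) (simp_all add: exterior_in_I_tr)
    with F(2) show "\<exists>V. exterior_in (exterior_prod Z I_tr) V \<and> h ` V \<subseteq> E"
      by (intro exI[of _ "F \<times> {0..1}"]) auto
  qed
  then show ?thesis
    unfolding exterior_map_iff by simp
qed

text \<open>A continuous self-map of the interval is automatically exterior on \<open>I_tr\<close>.
  The application is time reversal.\<close>

lemma exterior_map_reparametrize: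
  assumes h: "exterior_map (exterior_prod Z I_tr) X h"
    and \<phi>: "continuous_on {0..1} \<phi>" "\<phi> ` {0..1} \<subseteq> {0..1}"
  shows "exterior_map (exterior_prod Z I_tr) X (\<lambda>(z, t). h (z, \<phi> t))"
proof -
  have "exterior_map I_tr I_tr \<phi>"
    unfolding exterior_map_iff using \<phi> by (auto simp: exterior_in_I_tr image_subset_iff_funcset)
  then have "exterior_map (exterior_prod Z I_tr) (exterior_prod Z I_tr)
      (\<lambda>p. (fst p, (\<phi> \<circ> snd) p))"
    by (intro exterior_map_pairI exterior_map_fst exterior_map_compose[OF exterior_map_snd])
  from exterior_map_compose[OF this h] show ?thesis
    by (rule exterior_map_cong) auto
qed

definition concat_homotopy ::
    "('z \<times> real \<Rightarrow> 'a) \<Rightarrow> ('z \<times> real \<Rightarrow> 'a) \<Rightarrow> 'z \<times> real \<Rightarrow> 'a" where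
  "concat_homotopy h k =
     (\<lambda>(z, t). if t \<le> 1/2 then h (z, 2 * t) else k (z, 2 * t - 1))"

lemma concat_homotopy_simps [simp]:
  "concat_homotopy h k (z, 0) = h (z, 0)"
  "concat_homotopy h k (z, 1) = k (z, 1)"
  by (simp_all add: concat_homotopy_def)

text \<open>Continuity is the pasting of two maps along the closed halves of the time interval.
  Since the control sets of \<open>h\<close> and \<open>k\<close> are independent of time, their
  intersection controls both halves.\<close>

lemma exterior_map_concat_homotopy:
  assumes h: "exterior_map (exterior_prod Z I_tr) X h"
    and k: "exterior_map (exterior_prod Z I_tr) X k"
    and eq: "\<And>z. z \<in> points Z \<Longrightarrow> h (z, 1) = k (z, 0)"
  shows "exterior_map (exterior_prod Z I_tr) X (concat_homotopy h k)"
  unfolding exterior_map_prod_I_tr_iff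
proof (intro conjI allI impI)
  let ?ZI = "prod_topology (topology_of Z) (top_of_set {0..1::real})"
  let ?XZ = "topology_of X"
  have ch: "continuous_map ?ZI ?XZ h" and ck: "continuous_map ?ZI ?XZ k"
    using h k unfolding exterior_map_prod_I_tr_iff by auto
  have snd: "continuous_map (subtopology ?ZI A) euclideanreal snd" for A
    by (intro continuous_map_from_subtopology continuous_map_snd[THEN continuous_map_into_fulltopology])
  have fst: "continuous_map (subtopology ?ZI A) (topology_of Z) fst" for A
    by (intro continuous_map_from_subtopology continuous_map_fst)
  have "continuous_map ?ZI ?XZ
      (\<lambda>p. if snd p \<le> 1/2 then (h \<circ> (\<lambda>p. (fst p, 2 * snd p))) p
           else (k \<circ> (\<lambda>p. (fst p, 2 * snd p - 1))) p)"
  proof (rule continuous_map_cases_le)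
    show "continuous_map ?ZI euclideanreal snd"
      using snd[of UNIV] by simp
    show "continuous_map (subtopology ?ZI {p \<in> topspace ?ZI. snd p \<le> 1/2}) ?XZ
        (h \<circ> (\<lambda>p. (fst p, 2 * snd p)))"
      by (rule continuous_map_compose[OF _ ch])
        (auto intro!: continuous_map_pairedI fst
          continuous_map_into_subtopology continuous_map_real_mult snd)
    show "continuous_map (subtopology ?ZI {p \<in> topspace ?ZI. 1/2 \<le> snd p}) ?XZ
        (k \<circ> (\<lambda>p. (fst p, 2 * snd p - 1)))"
      by (rule continuous_map_compose[OF _ ck])
        (auto intro!: continuous_map_pairedI fst
          continuous_map_into_subtopology continuous_map_diff continuous_map_real_mult snd)
    show "(h \<circ> (\<lambda>p. (fst p, 2 * snd p))) p = (k \<circ> (\<lambda>p. (fst p, 2 * snd p - 1))) p"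
      if "p \<in> topspace ?ZI" "snd p = 1/2" for p
    proof -
      \<comment> \<open>At time \<open>1/2\<close> the rescaled times are \<open>1\<close> for
        \<open>h\<close> and \<open>0\<close> for \<open>k\<close>, which is where the two
        homotopies are assumed to agree.\<close>
      have "h (fst p, 1) = k (fst p, 0)"
        using that eq by auto
      then show ?thesis
        by (simp add: that)
    qed
  qed simp
  then show "continuous_map ?ZI ?XZ (concat_homotopy h k)"
    by (rule continuous_map_eq) (auto simp: concat_homotopy_def)
  fix E assume E: "exterior_in X E"
  obtain F where F: "exterior_in Z F" "\<forall>z\<in>F. \<forall>t\<in>{0..1}. h (z, t) \<in> E"
    using h E unfolding exterior_map_prod_I_tr_iff by blast
  obtain F' where F': "exterior_in Z F'" "\<forall>z\<in>F'. \<forall>t\<in>{0..1}. k (z, t) \<in> E"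
    using k E unfolding exterior_map_prod_I_tr_iff by blast
  show "\<exists>F. exterior_in Z F \<and> (\<forall>z\<in>F. \<forall>t\<in>{0..1}. concat_homotopy h k (z, t) \<in> E)"
    using exterior_in_Int[OF F(1) F'(1)] F(2) F'(2)
    by (intro exI[of _ "F \<inter> F'"]) (auto simp: concat_homotopy_def)
qed

section \<open>The exponential law for paths\<close>

text \<open>This is the tube lemma: projection along a compact factor is a closed map, so the
  parameters whose path leaves \<open>U\<close> at some time in \<open>K\<close> form a closed set.
  The \<open>restrict\<close> makes the values extensional, as points of the path space must
  be.\<close>

lemma continuous_map_curry_path:
  assumes h: "continuous_map (prod_topology Z (top_of_set {0..1})) T h"
  shows "continuous_map Z (path_topology T) (\<lambda>z. restrict (\<lambda>t. h (z, t)) {0..1})" (is "continuous_map _ _ ?g")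
proof -
  have path: "continuous_map (top_of_set {0..1}) T (?g z)" if "z \<in> topspace Z" for z
  proof -
    have "continuous_map (top_of_set {0..1}) T (h \<circ> (\<lambda>t. (z, t)))"
      using that by (intro continuous_map_compose[OF _ h] continuous_map_pairedI) auto
    then show ?thesis
      by (rule continuous_map_eq) auto
  qed
  let ?B = "\<lambda>K U. {f \<in> extensional {0..1}. continuous_map (top_of_set {0..1}) T f \<and> f ` K \<subseteq> U}"
  have "openin Z (?g -` ?B K U \<inter> topspace Z)"
    if K: "compactin (top_of_set {0..1}) K" and U: "openin T U" for K U
  proof -
    have K01: "K \<subseteq> {0..1}" and cK: "compact_space (top_of_set K)"
      using K by (auto simp: compactin_subtopology compact_space_subtopology)
    \<comment> \<open>The time factor is cut down to \<open>K\<close>, because the subbasic set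
      \<open>?B K U\<close> only tests times in \<open>K\<close>.\<close>
    have hK: "continuous_map (prod_topology Z (top_of_set K)) T h"
      using continuous_map_from_subtopology[OF h, of "topspace Z \<times> K"] K01
      by (simp add: prod_topology_subtopology subtopology_subtopology Int_absorb1 Times_Int_Times)
    \<comment> \<open>The bad pairs: their projection to \<open>Z\<close> is exactly the complement
      of the preimage of \<open>?B K U\<close>.\<close>
    let ?C = "{p \<in> topspace (prod_topology Z (top_of_set K)). h p \<in> topspace T - U}"
    have "closedin Z (fst ` ?C)"
      using closed_map_fst[OF cK, of Z] closedin_continuous_map_preimage[OF hK] U
      unfolding closed_map_def by blast
    then have "openin Z (topspace Z - fst ` ?C)"
      by blast
    also have "topspace Z - fst ` ?C = ?g -` ?B K U \<inter> topspace Z"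
    proof -
      have C: "z \<in> fst ` ?C \<longleftrightarrow> (\<exists>t\<in>K. h (z, t) \<notin> U)" if "z \<in> topspace Z" for z
        using that continuous_map_image_subset_topspace[OF hK] by (force simp: image_iff)
      have B: "?g z \<in> ?B K U \<longleftrightarrow> (\<forall>t\<in>K. h (z, t) \<in> U)" if "z \<in> topspace Z" for z
        using path[OF that] K01 by (auto simp: image_subset_iff)
      show ?thesis
      proof (rule set_eqI)
        fix z
        show "z \<in> topspace Z - fst ` ?C \<longleftrightarrow> z \<in> ?g -` ?B K U \<inter> topspace Z"
        proof (cases "z \<in> topspace Z")
          case True
          have "z \<notin> fst ` ?C \<longleftrightarrow> ?g z \<in> ?B K U"
            unfolding B[OF True] C[OF True] by blast
          with True show ?thesis
            by (simp only: Diff_iff Int_iff vimage_eq simp_thms)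
        qed simp
      qed
    qed
    finally show ?thesis .
  qed
  \<comment> \<open>The compact-open topology is generated by the sets \<open>?B K U\<close>, so
    besides their preimages only the values of \<open>?g\<close> need checking.\<close>
  moreover have "?g ` topspace Z \<subseteq> topspace (path_topology T)"
    using path by (auto simp: topspace_path_topology)
  ultimately show ?thesis
    unfolding path_topology_def compact_open_topology_def continuous_on_generated_topo_iff
      topology_generated_by_topspace
    by auto
qed

text \<open>Local compactness of the interval makes evaluation continuous: around a time
  \<open>t\<close> with \<open>g z t \<in> V\<close>, a compact neighbourhood of \<open>t\<close> is
  sent into \<open>V\<close> by \<open>g z\<close>, and hence by \<open>g z'\<close> for all
  \<open>z'\<close> near \<open>z\<close>.\<close>

lemma continuous_map_uncurry_path:
  assumes g: "continuous_map Z (path_topology T) g"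
  shows "continuous_map (prod_topology Z (top_of_set {0..1})) T (\<lambda>(z, t). g z t)"
proof -
  have path: "continuous_map (top_of_set {0..1}) T (g z)" "g z \<in> extensional {0..1}"
    if "z \<in> topspace Z" for z
    using g that by (auto simp: continuous_map_def topspace_path_topology Pi_iff)
  have "openin (prod_topology Z (top_of_set {0..1}))
      {p \<in> topspace (prod_topology Z (top_of_set {0..1})). (\<lambda>(z, t). g z t) p \<in> V}" (is "openin _ ?S")
    if V: "openin T V" for V
  proof (subst openin_subopen, rule ballI)
    fix p assume "p \<in> ?S"
    then obtain z t where p: "p = (z, t)" and z: "z \<in> topspace Z" and t: "t \<in> {0..1}"
      and gzt: "g z t \<in> V"
      by auto
    have "openin (top_of_set {0..1}) {t \<in> {0..1}. g z t \<in> V}"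
      using openin_continuous_map_preimage[OF path(1)[OF z] V] by simp
    \<comment> \<open>A closed ball is chosen so that \<open>?C\<close> is compact and
      \<open>?W\<close> is open in the path space; the open ball of the same radius then serves as
      the time factor of the neighbourhood \<open>?N\<close>.\<close>
    then obtain e where e: "e > 0" "cball t e \<inter> {0..1} \<subseteq> {t \<in> {0..1}. g z t \<in> V}"
      using t gzt unfolding openin_contains_cball by blast
    let ?C = "cball t e \<inter> {0..1}"
    let ?W = "{\<gamma> \<in> extensional {0..1}. continuous_map (top_of_set {0..1}) T \<gamma> \<and> \<gamma> ` ?C \<subseteq> V}"
    have "openin Z {z \<in> topspace Z. g z \<in> ?W}"
      using V by (intro openin_continuous_map_preimage[OF g] openin_path_topology_image_subset
          compact_Int_closed) auto
    moreover have "openin (top_of_set {0..1}) (ball t e \<inter> {0..1})"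
      by (auto simp: openin_open)
    ultimately have "openin (prod_topology Z (top_of_set {0..1}))
        ({z \<in> topspace Z. g z \<in> ?W} \<times> (ball t e \<inter> {0..1}))" (is "openin _ ?N")
      by (simp add: openin_prod_Times_iff)
    moreover have "(z, t) \<in> ?N"
    proof -
      have "g z ` ?C \<subseteq> V"
        using e(2) by blast
      then show ?thesis
        using path[OF z] z t e(1) by simp
    qed
    moreover have "?N \<subseteq> ?S"
    proof (rule subsetI)
      fix p assume "p \<in> ?N"
      then obtain z' t' where p: "p = (z', t')" "z' \<in> topspace Z" "g z' ` ?C \<subseteq> V"
        "t' \<in> ball t e" "t' \<in> {0..1}"
        by blast
      then have "g z' t' \<in> V"
        by (intro subsetD[OF p(3)] imageI IntI) simp_all
      with p show "p \<in> ?S"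
        by simp
    qed
    ultimately show "\<exists>N. openin (prod_topology Z (top_of_set {0..1})) N \<and> p \<in> N \<and> N \<subseteq> ?S"
      unfolding p by (intro exI[of _ ?N] conjI)
  qed
  moreover have "g z t \<in> topspace T" if "z \<in> topspace Z" "t \<in> {0..1}" for z t
    using path(1)[OF that(1)] that(2) by (auto simp: continuous_map_def Pi_iff)
  ultimately show ?thesis
    unfolding continuous_map_def by (auto simp: split_beta)
qed

text \<open>Control of \<open>h\<close> uniform in time says that the whole path over a point of
  \<open>F\<close> stays in \<open>E\<close>, which is how exterior sets of the path space are
  generated.\<close>

lemma exterior_map_curry:
  assumes h: "exterior_map (exterior_prod Z I_tr) X h"
  shows "exterior_map Z (exterior_path_space X) (\<lambda>z. restrict (\<lambda>t. h (z, t)) {0..1})" (is "exterior_map _ _ ?g")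
  unfolding exterior_map_iff
proof (intro conjI allI impI)
  show c: "continuous_map (topology_of Z) (topology_of (exterior_path_space X)) ?g"
    using h unfolding exterior_map_prod_I_tr_iff by (simp add: continuous_map_curry_path)
  fix V assume "exterior_in (exterior_path_space X) V"
  then obtain E where E: "exterior_in X E"
    "{\<gamma> \<in> topspace (path_topology (topology_of X)). \<gamma> ` {0..1} \<subseteq> E} \<subseteq> V"
    unfolding exterior_in_path_space by blast
  obtain F where F: "exterior_in Z F" "\<forall>z\<in>F. \<forall>t\<in>{0..1}. h (z, t) \<in> E"
    using h E unfolding exterior_map_prod_I_tr_iff by blast
  have "?g z \<in> V" if "z \<in> F" for z
  proof (rule subsetD[OF E(2)])
    have "z \<in> points Z"
      using that exterior_in_subset[OF F(1)] by blast
    then have "?g z \<in> topspace (path_topology (topology_of X))"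
      using c by (auto simp: continuous_map_def Pi_iff)
    then show "?g z \<in> {\<gamma> \<in> topspace (path_topology (topology_of X)). \<gamma> ` {0..1} \<subseteq> E}"
      using F(2) that by auto
  qed
  with F(1) show "\<exists>F. exterior_in Z F \<and> ?g ` F \<subseteq> V"
    by blast
qed

text \<open>The generating set is itself open, being the subbasic set for the compact set
  \<open>{0..1}\<close>.\<close>

lemma exterior_in_paths_within:
  assumes "exterior_in X E"
  shows "exterior_in (exterior_path_space X)
    {\<gamma> \<in> topspace (path_topology (topology_of X)). \<gamma> ` {0..1} \<subseteq> E}"
  unfolding exterior_in_path_space
  using openin_path_topology_image_subset[of "{0..1}" "topology_of X" E] assms
  by (auto simp: topspace_path_topology exterior_in_openin)

lemma exterior_map_uncurry:
  assumes g: "exterior_map Z (exterior_path_space X) g"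
  shows "exterior_map (exterior_prod Z I_tr) X (\<lambda>(z, t). g z t)"
  unfolding exterior_map_prod_I_tr_iff
proof (intro conjI allI impI)
  show "continuous_map (prod_topology (topology_of Z) (top_of_set {0..1})) (topology_of X)
      (\<lambda>(z, t). g z t)"
    using exterior_map_continuous[OF g] by (simp add: continuous_map_uncurry_path)
  fix E assume "exterior_in X E"
  from exterior_map_exteriorE[OF g exterior_in_paths_within[OF this]]
  obtain F where F: "exterior_in Z F"
    "\<And>z. z \<in> F \<Longrightarrow> g z \<in> {\<gamma> \<in> topspace (path_topology (topology_of X)). \<gamma> ` {0..1} \<subseteq> E}"
    by metis
  have "g z t \<in> E" if "z \<in> F" "t \<in> {0..1}" for z t
    using F(2)[OF that(1)] that(2) by (auto simp: image_subset_iff)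
  with F(1) show "\<exists>F. exterior_in Z F \<and> (\<forall>z\<in>F. \<forall>t\<in>{0..1}. (case (z, t) of (z, t) \<Rightarrow> g z t) \<in> E)"
    by auto
qed

lemma exterior_map_path_eval:
  assumes t: "t \<in> {0..1}"
  shows "exterior_map (exterior_path_space X) X (\<lambda>\<gamma>. \<gamma> t)"
  unfolding exterior_map_iff
proof (intro conjI allI impI)
  show "continuous_map (topology_of (exterior_path_space X)) (topology_of X) (\<lambda>\<gamma>. \<gamma> t)"
    using t by (simp add: continuous_map_path_eval)
  fix E assume "exterior_in X E"
  from exterior_in_paths_within[OF this]
  show "\<exists>F. exterior_in (exterior_path_space X) F \<and> (\<lambda>\<gamma>. \<gamma> t) ` F \<subseteq> E"
    using t by (intro exI[of _ "{\<gamma> \<in> topspace (path_topology (topology_of X)). \<gamma> ` {0..1} \<subseteq> E}"]) auto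
qed

section \<open>Sectional sets\<close>

text \<open>The stationary homotopy \<open>f \<circ> fst\<close> works. Equality is asked on
  \<open>points X\<close> only, which covers strict sections, whose equation holds on the open set
  alone.\<close>

lemma exterior_homotopic_refl:
  assumes "exterior_map X Y f" "\<And>x. x \<in> points X \<Longrightarrow> f x = g x"
  shows "exterior_homotopic X Y f g"
  unfolding exterior_homotopic_def
  using assms exterior_map_cong[OF assms] exterior_map_compose[OF exterior_map_fst assms(1)]
  by (auto intro!: exI[of _ "f \<circ> fst"])

lemma exterior_homotopic_trans:
  assumes "exterior_homotopic X Y f g" "exterior_homotopic X Y g h"
  shows "exterior_homotopic X Y f h"
proof -
  obtain H where H: "exterior_map (exterior_prod X I_tr) Y H"
    "\<forall>x \<in> points X. H (x, 0) = f x \<and> H (x, 1) = g x"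
    using assms(1) unfolding exterior_homotopic_def by blast
  obtain K where K: "exterior_map (exterior_prod X I_tr) Y K"
    "\<forall>x \<in> points X. K (x, 0) = g x \<and> K (x, 1) = h x"
    using assms(2) unfolding exterior_homotopic_def by blast
  have "exterior_map (exterior_prod X I_tr) Y (concat_homotopy H K)"
    using H K by (intro exterior_map_concat_homotopy) auto
  with H K assms show ?thesis
    unfolding exterior_homotopic_def by (auto intro!: exI[of _ "concat_homotopy H K"])
qed

text \<open>The homotopy is precomposed with the product of \<open>s\<close> and the identity of the
  time interval.\<close>

lemma exterior_homotopic_precompose:
  assumes s: "exterior_map W X s" and fg: "exterior_homotopic X Y f g"
  shows "exterior_homotopic W Y (f \<circ> s) (g \<circ> s)"
proof -
  obtain H where H: "exterior_map (exterior_prod X I_tr) Y H"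
    "\<forall>x \<in> points X. H (x, 0) = f x \<and> H (x, 1) = g x"
    and f: "exterior_map X Y f" and g: "exterior_map X Y g"
    using fg unfolding exterior_homotopic_def by blast
  have "exterior_map (exterior_prod W I_tr) Y (H \<circ> (\<lambda>p. ((s \<circ> fst) p, snd p)))"
    by (intro exterior_map_compose[OF _ H(1)] exterior_map_pairI exterior_map_snd
        exterior_map_compose[OF exterior_map_fst s])
  with H(2) exterior_map_points[OF s] exterior_map_compose[OF s f] exterior_map_compose[OF s g]
  show ?thesis
    unfolding exterior_homotopic_def
    by (auto intro!: exI[of _ "H \<circ> (\<lambda>p. ((s \<circ> fst) p, snd p))"])
qed

text \<open>If \<open>s\<close> is a homotopy section of \<open>f\<close>, then
  \<open>r \<circ> s\<close> is one of \<open>g\<close>, since \<open>g \<circ> r \<circ> s\<close>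
  deforms to \<open>f \<circ> s\<close> and then to the inclusion. Hence a map over \<open>Y\<close>
  up to homotopy carries sectional sets along.\<close>

lemma e_sectional_transfer:
  assumes U: "e_sectional A Y f U" and r: "exterior_map A B r"
    and fg: "exterior_homotopic A Y (g \<circ> r) f"
  shows "e_sectional B Y g U"
proof -
  obtain s where s: "exterior_map (exterior_subspace Y U) A s"
    "exterior_homotopic (exterior_subspace Y U) Y (f \<circ> s) (\<lambda>y. y)"
    using U unfolding e_sectional_def by blast
  have "exterior_homotopic (exterior_subspace Y U) Y ((g \<circ> r) \<circ> s) (\<lambda>y. y)"
    using exterior_homotopic_precompose[OF s(1) fg] s(2) by (rule exterior_homotopic_trans)
  then show ?thesis
    using U exterior_map_compose[OF s(1) r] unfolding e_sectional_def
    by (auto simp: comp_assoc intro!: exI[of _ "r \<circ> s"])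
qed

section \<open>Sectional sets of the diagonal and of the path fibration\<close>

lemma e_sectional_diagonal_iff_endpoints:
  "e_sectional X (exterior_prod X X) diagonal U \<longleftrightarrow>
   e_sectional (exterior_path_space X) (exterior_prod X X) endpoints U"
proof
  \<comment> \<open>The constant path at \<open>x\<close>, written as the curried first projection
    so that its exteriority follows from \<open>exterior_map_curry\<close>.\<close>
  let ?c = "\<lambda>x. restrict (\<lambda>t::real. fst (x, t)) {0..1}"
  assume "e_sectional X (exterior_prod X X) diagonal U"
  moreover have c: "exterior_map X (exterior_path_space X) ?c"
    by (rule exterior_map_curry[OF exterior_map_fst])
  moreover have "exterior_homotopic X (exterior_prod X X) (endpoints \<circ> ?c) diagonal"
    by (intro exterior_homotopic_refl exterior_map_compose[OF c] exterior_map_endpoints)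
      (simp add: endpoints_def diagonal_def)
  ultimately show "e_sectional (exterior_path_space X) (exterior_prod X X) endpoints U"
    by (rule e_sectional_transfer)
next
  let ?P = "exterior_path_space X"
  \<comment> \<open>The first coordinate stays at the starting point while the second runs along the
    path, from \<open>(\<gamma> 0, \<gamma> 0)\<close> to \<open>(\<gamma> 0, \<gamma> 1)\<close>.
    The second coordinate is the uncurried identity of the path space.\<close>
  let ?H = "\<lambda>p. (((\<lambda>\<gamma>. \<gamma> 0) \<circ> fst) p, (\<lambda>(\<gamma>, t). \<gamma> t) p)"
  assume "e_sectional ?P (exterior_prod X X) endpoints U"
  moreover have e: "exterior_map ?P X (\<lambda>\<gamma>. \<gamma> 0)"
    by (simp add: exterior_map_path_eval)
  moreover have "exterior_homotopic ?P (exterior_prod X X) (diagonal \<circ> (\<lambda>\<gamma>. \<gamma> 0)) endpoints"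
  proof -
    have "exterior_map (exterior_prod ?P I_tr) (exterior_prod X X) ?H"
      by (intro exterior_map_pairI exterior_map_compose[OF exterior_map_fst e]
          exterior_map_uncurry exterior_map_ident)
    then show ?thesis
      unfolding exterior_homotopic_def
      using exterior_map_compose[OF e exterior_map_diagonal] exterior_map_endpoints
      by (auto simp: endpoints_def diagonal_def intro!: exI[of _ ?H])
  qed
  ultimately show "e_sectional X (exterior_prod X X) diagonal U"
    by (rule e_sectional_transfer)
qed

text \<open>A homotopy section is made strict by joining to each path \<open>s p\<close> the tracks
  of its two endpoints under the homotopy. Conversely, a strict section is a homotopy section
  through the stationary homotopy.\<close>

lemma e_sectional_endpoints_iff_strict:
  "e_sectional (exterior_path_space X) (exterior_prod X X) endpoints U \<longleftrightarrow>
   openin (topology_of (exterior_prod X X)) U \<and>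
   (\<exists>\<sigma>. exterior_map (exterior_subspace (exterior_prod X X) U) (exterior_path_space X) \<sigma> \<and>
        (\<forall>p \<in> U. endpoints (\<sigma> p) = p))"
proof (intro iffI conjI)
  let ?Z = "exterior_subspace (exterior_prod X X) U"
  assume es: "e_sectional (exterior_path_space X) (exterior_prod X X) endpoints U"
  then show op: "openin (topology_of (exterior_prod X X)) U"
    by (simp add: e_sectional_def)
  have U: "points ?Z = U"
    using openin_subset[OF op] by auto
  obtain s H where s: "exterior_map ?Z (exterior_path_space X) s"
    and H: "exterior_map (exterior_prod ?Z I_tr) (exterior_prod X X) H"
    and H01: "\<And>p. p \<in> U \<Longrightarrow> H (p, 0) = (s p 0, s p 1)" "\<And>p. p \<in> U \<Longrightarrow> H (p, 1) = p"
    using es unfolding e_sectional_def exterior_homotopic_def U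
    by (auto simp: endpoints_def)
  \<comment> \<open>Time is reversed because \<open>H\<close> ends at \<open>p\<close>: the three
    pieces run from \<open>fst p\<close> to \<open>s p 0\<close>, then to \<open>s p 1\<close>, then
    to \<open>snd p\<close>.\<close>
  define h where "h = (\<lambda>(p, t). (fst \<circ> H) (p, 1 - t))"
  define k where "k = (\<lambda>(p, t). s p t)"
  have h: "exterior_map (exterior_prod ?Z I_tr) X h"
    unfolding h_def
    by (intro exterior_map_reparametrize exterior_map_compose[OF H exterior_map_fst])
      (auto intro!: continuous_intros)
  have k: "exterior_map (exterior_prod ?Z I_tr) X k"
    unfolding k_def by (rule exterior_map_uncurry[OF s])
  have l: "exterior_map (exterior_prod ?Z I_tr) X (snd \<circ> H)"
    by (rule exterior_map_compose[OF H exterior_map_snd])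
  have "exterior_map (exterior_prod ?Z I_tr) X
      (concat_homotopy (concat_homotopy h k) (snd \<circ> H))"
    by (intro exterior_map_concat_homotopy h k l; unfold U) (simp_all add: h_def k_def H01)
  from exterior_map_curry[OF this]
  show "\<exists>\<sigma>. exterior_map ?Z (exterior_path_space X) \<sigma> \<and> (\<forall>p \<in> U. endpoints (\<sigma> p) = p)"
    by (intro exI conjI, assumption) (simp add: endpoints_def h_def H01)
next
  let ?Z = "exterior_subspace (exterior_prod X X) U"
  assume R: "openin (topology_of (exterior_prod X X)) U \<and>
   (\<exists>\<sigma>. exterior_map ?Z (exterior_path_space X) \<sigma> \<and> (\<forall>p \<in> U. endpoints (\<sigma> p) = p))"
  then obtain \<sigma> where \<sigma>: "exterior_map ?Z (exterior_path_space X) \<sigma>"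
    "\<forall>p \<in> U. endpoints (\<sigma> p) = p"
    by blast
  have "exterior_homotopic ?Z (exterior_prod X X) (endpoints \<circ> \<sigma>) (\<lambda>p. p)"
    using \<sigma>(2) by (intro exterior_homotopic_refl exterior_map_compose[OF \<sigma>(1)] exterior_map_endpoints) auto
  with R \<sigma>(1) show "e_sectional (exterior_path_space X) (exterior_prod X X) endpoints U"
    unfolding e_sectional_def by blast
qed

text \<open>Both invariants count members of covers, and the conditions on a single member are
  equivalent.\<close>

theorem e_TC_eq_e_secat_endpoints:
  "e_TC X = e_secat (exterior_path_space X) (exterior_prod X X) endpoints"
  unfolding e_TC_def e_secat_def e_sectional_endpoints_iff_strict ..

theorem e_secat_diagonal_eq_endpoints:
  "e_secat X (exterior_prod X X) diagonal =
   e_secat (exterior_path_space X) (exterior_prod X X) endpoints"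
  unfolding e_secat_def e_sectional_diagonal_iff_endpoints ..

section \<open>The cocompact externology\<close>

text \<open>In a Hausdorff space compact sets are closed, so the exterior sets of
  \<open>cocompact T\<close> are the complements of arbitrary compact sets. The \<open>K\<close> and
  \<open>L\<close> clause is then the existence of control sets for the generators of the path
  externology.\<close>

lemma exterior_map_cocompact_path_iff:
  assumes T: "Hausdorff_space T" and U: "openin (prod_topology T T) U"
  shows "exterior_map (exterior_subspace (exterior_prod (cocompact T) (cocompact T)) U)
           (exterior_path_space (cocompact T)) \<sigma> \<longleftrightarrow>
         continuous_map (subtopology (prod_topology T T) U) (path_topology T) \<sigma> \<and>
         (\<forall>K. compactin T K \<longrightarrow> (\<exists>L. compactin T L \<and> K \<subseteq> L \<and>
            (\<forall>p \<in> U \<inter> (topspace T - L) \<times> (topspace T - L). \<sigma> p ` {0..1} \<subseteq> topspace T - K)))"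
    (is "exterior_map ?Z ?P \<sigma> \<longleftrightarrow> ?c \<and> ?proper")
proof (intro iffI conjI allI impI)
  assume \<sigma>: "exterior_map ?Z ?P \<sigma>"
  then show ?c
    using exterior_map_continuous by fastforce
  fix K assume K: "compactin T K"
  then have "exterior_in (cocompact T) (topspace T - K)"
    using compactin_imp_closedin[OF T] by (auto simp: exterior_in_cocompact)
  from exterior_map_exteriorE[OF \<sigma> exterior_in_paths_within[OF this]]
  obtain F where F: "exterior_in ?Z F" "\<And>p. p \<in> F \<Longrightarrow> \<sigma> p ` {0..1} \<subseteq> topspace T - K"
    by (metis (mono_tags, lifting) mem_Collect_eq)
  then obtain V K1 K2 where V: "V \<inter> U \<subseteq> F"
    and K12: "compactin T K1" "compactin T K2" "(topspace T - K1) \<times> (topspace T - K2) \<subseteq> V"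
    unfolding exterior_in_subspace exterior_in_prod exterior_in_cocompact by blast
  show "\<exists>L. compactin T L \<and> K \<subseteq> L \<and>
      (\<forall>p \<in> U \<inter> (topspace T - L) \<times> (topspace T - L). \<sigma> p ` {0..1} \<subseteq> topspace T - K)"
  \<comment> \<open>The product externology gives separate compact sets for the two factors; their
    union serves for both, and \<open>K\<close> is added to ensure
    \<open>K \<subseteq> L\<close>.\<close>
  proof (intro exI[of _ "K \<union> K1 \<union> K2"] conjI ballI)
    show "compactin T (K \<union> K1 \<union> K2)"
      using K K12 by (simp add: compactin_Un)
    fix p assume "p \<in> U \<inter> (topspace T - (K \<union> K1 \<union> K2)) \<times> (topspace T - (K \<union> K1 \<union> K2))"
    then have "p \<in> F"
      using V K12(3) by blast
    then show "\<sigma> p ` {0..1} \<subseteq> topspace T - K"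
      by (rule F(2))
  qed blast
next
  assume R: "?c \<and> ?proper"
  show "exterior_map ?Z ?P \<sigma>"
    unfolding exterior_map_iff
  proof (intro conjI allI impI)
    show "continuous_map (topology_of ?Z) (topology_of ?P) \<sigma>"
      using R by simp
    fix V assume "exterior_in ?P V"
    then obtain K where K: "compactin T K"
      "{\<gamma> \<in> topspace (path_topology T). \<gamma> ` {0..1} \<subseteq> topspace T - K} \<subseteq> V"
      unfolding exterior_in_path_space exterior_in_cocompact by auto
    obtain L where L: "compactin T L"
      "\<forall>p \<in> U \<inter> (topspace T - L) \<times> (topspace T - L). \<sigma> p ` {0..1} \<subseteq> topspace T - K"
      using R K(1) by blast
    let ?E = "(topspace T - L) \<times> (topspace T - L)"
    have "exterior_in (cocompact T) (topspace T - L)"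
      using L(1) compactin_imp_closedin[OF T] by (auto simp: exterior_in_cocompact)
    then have E: "exterior_in (exterior_prod (cocompact T) (cocompact T)) ?E"
      by (intro exterior_in_Times)
    then have "exterior_in ?Z (?E \<inter> U)"
      using exterior_in_openin[OF E] unfolding exterior_in_subspace openin_subtopology by blast
    moreover have "\<sigma> p \<in> V" if "p \<in> ?E \<inter> U" for p
    proof (rule subsetD[OF K(2)])
      \<comment> \<open>Membership in \<open>V\<close> also requires \<open>\<sigma> p\<close> to be
        a point of the path space, which continuity supplies for points of the domain.\<close>
      have "p \<in> topspace (subtopology (prod_topology T T) U)"
        using that by auto
      then have "\<sigma> p \<in> topspace (path_topology T)"
        using R by (auto simp: continuous_map_def Pi_iff)
      then show "\<sigma> p \<in> {\<gamma> \<in> topspace (path_topology T). \<gamma> ` {0..1} \<subseteq> topspace T - K}"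
        using L(2) that by auto
    qed
    ultimately show "\<exists>F. exterior_in ?Z F \<and> \<sigma> ` F \<subseteq> V"
      by blast
  qed
qed

theorem p_TC_eq_e_TC_cocompact:
  assumes "Hausdorff_space T"
  shows "p_TC T = e_TC (cocompact T)"
proof -
  have "(openin (prod_topology T T) U \<and>
         (\<exists>\<sigma>. continuous_map (subtopology (prod_topology T T) U) (path_topology T) \<sigma> \<and>
             (\<forall>p \<in> U. endpoints (\<sigma> p) = p) \<and>
             (\<forall>K. compactin T K \<longrightarrow> (\<exists>L. compactin T L \<and> K \<subseteq> L \<and>
                (\<forall>p \<in> U \<inter> (topspace T - L) \<times> (topspace T - L).
                   \<sigma> p ` {0..1} \<subseteq> topspace T - K))))) \<longleftrightarrow>
      (openin (topology_of (exterior_prod (cocompact T) (cocompact T))) U \<and>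
         (\<exists>\<sigma>. exterior_map (exterior_subspace (exterior_prod (cocompact T) (cocompact T)) U)
               (exterior_path_space (cocompact T)) \<sigma> \<and> (\<forall>p \<in> U. endpoints (\<sigma> p) = p)))" for U
  \<comment> \<open>For open \<open>U\<close> the preceding equivalence applies; otherwise both
    sides are false.\<close>
  proof (cases "openin (prod_topology T T) U")
    case True
    show ?thesis
      unfolding exterior_map_cocompact_path_iff[OF assms True] topology_of_simps
      \<comment> \<open>After the rewriting only the order of the conjuncts under the existential
        differs: the section equation stands between continuity and the compactness clause on one
        side.\<close>
      by (rule arg_cong2[where f = "(\<and>)", OF refl ex_cong1]) (simp only: conj_ac)
  qed simp
  then show ?thesis
    unfolding p_TC_def e_TC_def by simp
qed

theorem theorem0p3:
  fixes X :: "'a topology"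
  assumes "metrizable_space X"
  shows "p_TC X = e_TC (cocompact X) \<and>
         e_TC (cocompact X) =
           e_secat (exterior_path_space (cocompact X))
                   (exterior_prod (cocompact X) (cocompact X)) endpoints \<and>
         p_TC X =
           e_secat (cocompact X) (exterior_prod (cocompact X) (cocompact X)) diagonal"
  \<comment> \<open>Every invariant in the chain is rewritten to the sectional category of
    \<open>endpoints\<close>.\<close>
  using p_TC_eq_e_TC_cocompact[OF metrizable_imp_Hausdorff_space[OF assms]]
  by (simp only: e_TC_eq_e_secat_endpoints e_secat_diagonal_eq_endpoints)

end
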